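(* Let $v,w\ge 0$ be integers with $v\le 2w$. Then $$wavecost\ \mathscr{MON}(v+w,v;4,2)=wavecost\ \mathscr{MON}(v+w,4).$$
   Context: Let $n\ge v\ge 0$ and let $C>C'\ge 1$ be integers. Let $X$ be a set of $n$ vertices, $K_n$ the complete graph on $X$, and $V\subseteq X$ a fixed subset with $|V|=v$; write $w=n-v$. A grooming $N(n,C)$ is a partition of the edge set $E(K_n)$ into (nonempty, not necessarily connected) subgraphs $B_1,\dots,B_\Lambda$ of $K_n$, without isolated vertices, such that $|E(B_k)|\le C$ for all $k$. A grooming $N(n,v;C,C')$ is an $N(n,C)$ in which, moreover, each $B_k$ contains at most $C'$ edges having both ends in $V$. The (drop) cost of a grooming is $\sum_{k=1}^{\Lambda}|V(B_k)|$, and its number of wavelengths (wavecost) is $\Lambda$. $\mathscr{ON}(n,C)$ (respectively $\mathscr{ON}(n,v;C,C')$) denotes a grooming $N(n,C)$ (respectively $N(n,v;C,C')$) of minimum cost. $\mathscr{MON}(n,C)$ (respectively $\mathscr{MON}(n,v;C,C')$) denotes one whose number of wavelengths is minimum among all $\mathscr{ON}(n,C)$ (respectively all $\mathscr{ON}(n,v;C,C')$), i.e. among minimum-cost groomings only, and $wavecost\ \mathscr{MON}(\cdot)$ denotes that minimum number of wavelengths. *)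

theory Defs
  imports Main "HOL-Library.Disjoint_Sets"
begin

definition complete_edges :: "'a set \<Rightarrow> 'a set set" where
  "complete_edges X = {e. e \<subseteq> X \<and> card e = 2}"

text \<open>A subgraph without isolated vertices is represented by its edge set \<open>B\<close>;
  its vertex set is then \<open>\<Union>B\<close>.\<close>

definition grooming :: "'a set \<Rightarrow> nat \<Rightarrow> 'a set set set \<Rightarrow> bool" where
  "grooming X C Bs \<longleftrightarrow>
     partition_on (complete_edges X) Bs \<and> (\<forall>B\<in>Bs. card B \<le> C)"

definition grooming2 :: "'a set \<Rightarrow> 'a set \<Rightarrow> nat \<Rightarrow> nat \<Rightarrow> 'a set set set \<Rightarrow> bool" where
  "grooming2 X V C C' Bs \<longleftrightarrow>
     grooming X C Bs \<and> (\<forall>B\<in>Bs. card {e \<in> B. e \<subseteq> V} \<le> C')"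

definition drop_cost :: "'a set set set \<Rightarrow> nat" where
  "drop_cost Bs = (\<Sum>B\<in>Bs. card (\<Union>B))"

definition ON :: "'a set \<Rightarrow> nat \<Rightarrow> 'a set set set \<Rightarrow> bool" where
  "ON X C Bs \<longleftrightarrow> is_arg_min drop_cost (grooming X C) Bs"

definition ON2 :: "'a set \<Rightarrow> 'a set \<Rightarrow> nat \<Rightarrow> nat \<Rightarrow> 'a set set set \<Rightarrow> bool" where
  "ON2 X V C C' Bs \<longleftrightarrow> is_arg_min drop_cost (grooming2 X V C C') Bs"

text \<open>The number of wavelengths of a grooming \<open>Bs\<close> is \<open>card Bs\<close>.\<close>

definition MON :: "'a set \<Rightarrow> nat \<Rightarrow> 'a set set set \<Rightarrow> bool" where
  "MON X C Bs \<longleftrightarrow> is_arg_min card (ON X C) Bs"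

definition MON2 :: "'a set \<Rightarrow> 'a set \<Rightarrow> nat \<Rightarrow> nat \<Rightarrow> 'a set set set \<Rightarrow> bool" where
  "MON2 X V C C' Bs \<longleftrightarrow> is_arg_min card (ON2 X V C C') Bs"

text \<open>The minima below are attained whenever \<open>X\<close> is finite and \<open>C, C' \<ge> 1\<close>;
  see \<open>MON_exists\<close> and \<open>MON2_exists\<close>.\<close>

definition wavecost_MON :: "'a set \<Rightarrow> nat \<Rightarrow> nat" where
  "wavecost_MON X C = (LEAST l. \<exists>Bs. MON X C Bs \<and> card Bs = l)"

definition wavecost_MON2 :: "'a set \<Rightarrow> 'a set \<Rightarrow> nat \<Rightarrow> nat \<Rightarrow> nat" where
  "wavecost_MON2 X V C C' = (LEAST l. \<exists>Bs. MON2 X V C C' Bs \<and> card Bs = l)"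

lemma ex_is_arg_min_nat:
  fixes f :: "'b \<Rightarrow> nat"
  assumes "P x"
  shows "\<exists>y. is_arg_min f P y"
  using ex_has_least_nat[of P x f] assms by (auto simp: is_arg_min_def not_less)

lemma grooming2_singletons:
  assumes "1 \<le> C" "1 \<le> C'"
  shows "grooming2 X V C C' ((\<lambda>e. {e}) ` complete_edges X)"
proof -
  have "card {e' \<in> {e}. e' \<subseteq> V} \<le> 1" for e :: "'a set"
    using card_mono[of "{e}" "{e' \<in> {e}. e' \<subseteq> V}"] by auto
  then have "card {e' \<in> {e}. e' \<subseteq> V} \<le> C'" for e :: "'a set"
    using assms(2) order_trans by blast
  then show ?thesis
    using assms(1)
    by (auto simp: grooming2_def grooming_def partition_on_def disjoint_def)
qed

lemma MON_exists: "1 \<le> C \<Longrightarrow> \<exists>Bs. MON X C Bs"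
  unfolding MON_def ON_def
  by (metis ex_is_arg_min_nat grooming2_def grooming2_singletons order_refl)

lemma MON2_exists: "1 \<le> C \<Longrightarrow> 1 \<le> C' \<Longrightarrow> \<exists>Bs. MON2 X V C C' Bs"
  unfolding MON2_def ON2_def
  by (metis ex_is_arg_min_nat grooming2_singletons)

lemma card_MON: "MON X C Bs \<Longrightarrow> card Bs = wavecost_MON X C"
  unfolding wavecost_MON_def
  by (rule Least_equality[symmetric]) (auto simp: MON_def is_arg_min_def not_less)

lemma card_MON2: "MON2 X V C C' Bs \<Longrightarrow> card Bs = wavecost_MON2 X V C C'"
  unfolding wavecost_MON2_def
  by (rule Least_equality[symmetric]) (auto simp: MON2_def is_arg_min_def not_less)

end

theory Submission
  imports Defs "HOL-Library.Code_Binary_Nat"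
begin

text \<open>A block with at most four edges has at least as many vertices as edges. Hence a grooming all of
  whose blocks have equally many vertices and edges (triangles, 4-cycles, triangles with a pendant
  edge) has minimum cost, and if at most three edges are missing for all blocks to have four edges,
  it also has the minimum number of wavelengths. For \<open>n \<le> 4\<close> the condition on \<open>V\<close> is vacuous, since
  \<open>|V| \<le> 2\<close>. For \<open>n \<ge> 5\<close> such a grooming with at most two edges of every block inside \<open>V\<close> exists even
  when \<open>|V| = \<lfloor>2n/3\<rfloor>\<close>, the largest size allowed: 24 new vertices, 16 of them in \<open>V\<close>, are added at a
  time. The edges between the old and the new vertices split into 4-cycles, apart from those at a
  constant set of at most three old vertices (the hole), which are absorbed in a fixed
  decomposition. Only finitely many small decompositions have to be given explicitly.\<close>

section \<open>Tight blocks and decompositions into them\<close>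

definition tight_block :: "'a set \<Rightarrow> 'a set set \<Rightarrow> bool" where
  "tight_block V B \<longleftrightarrow> card B \<le> 4 \<and> card (\<Union>B) = card B \<and> card {e \<in> B. e \<subseteq> V} \<le> 2"

text \<open>The parameter \<open>t\<close> is the number of edges missing for all blocks to have four edges.\<close>

definition tight :: "'a set \<Rightarrow> 'a set set \<Rightarrow> nat \<Rightarrow> bool" where
  "tight V E t \<longleftrightarrow> finite E \<and>
     (\<exists>Bs. partition_on E Bs \<and> (\<forall>B\<in>Bs. tight_block V B) \<and> 4 * card Bs = card E + t)"

lemma finite_complete_edges: "finite X \<Longrightarrow> finite (complete_edges X)"
  by (rule finite_subset[of _ "Pow X"]) (auto simp: complete_edges_def)

lemma tight_empty: "tight V {} 0"
  by (auto simp: tight_def partition_on_empty)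

text \<open>The numbers of missing edges add up, which is why later constructions track the exact
  value of \<open>t\<close> and not merely \<open>t < 4\<close>.\<close>

lemma tight_Un:
  assumes "tight V E s" "tight V F t" "E \<inter> F = {}"
  shows "tight V (E \<union> F) (s + t)"
proof -
  obtain Bs where Bs: "partition_on E Bs" "\<forall>B\<in>Bs. tight_block V B" "4 * card Bs = card E + s"
    and fE: "finite E" using assms(1) by (auto simp: tight_def)
  obtain Cs where Cs: "partition_on F Cs" "\<forall>B\<in>Cs. tight_block V B" "4 * card Cs = card F + t"
    and fF: "finite F" using assms(2) by (auto simp: tight_def)
  have cross: "B \<inter> C = {}" if "B \<in> Bs" "C \<in> Cs" for B C
    using that partition_onD1[OF Bs(1)] partition_onD1[OF Cs(1)] assms(3) by auto
  have "partition_on (E \<union> F) (Bs \<union> Cs)"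
  proof (rule partition_onI)
    show "\<Union> (Bs \<union> Cs) = E \<union> F"
      using partition_onD1[OF Bs(1)] partition_onD1[OF Cs(1)] by auto
    show "{} \<notin> Bs \<union> Cs"
      using partition_onD3[OF Bs(1)] partition_onD3[OF Cs(1)] by auto
    fix B C assume "B \<in> Bs \<union> Cs" "C \<in> Bs \<union> Cs" "B \<noteq> C"
    then show "disjnt B C"
      using disjointD[OF partition_onD2[OF Bs(1)], of B C] cross[of B C] cross[of C B]
        disjointD[OF partition_onD2[OF Cs(1)], of B C]
      unfolding disjnt_def by blast
  qed
  \<comment> \<open>A block common to both partitions would be disjoint from itself, hence
    empty.\<close>
  moreover have "Bs \<inter> Cs = {}"
    using cross partition_onD3[OF Bs(1)] by fastforce
  then have "card (Bs \<union> Cs) = card Bs + card Cs"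
    by (intro card_Un_disjoint finite_elements[OF fE Bs(1)] finite_elements[OF fF Cs(1)])
  moreover have "card (E \<union> F) = card E + card F"
    using fE fF assms(3) by (rule card_Un_disjoint)
  ultimately show ?thesis
    using Bs Cs fE fF unfolding tight_def
    by (intro conjI exI[of _ "Bs \<union> Cs"]) auto
qed

lemma tight_single:
  assumes "tight_block V B" "finite B" "B \<noteq> {}" "card B + t = 4"
  shows "tight V B t"
  using assms partition_on_space[of B] unfolding tight_def by (intro conjI exI[of _ "{B}"]) auto

text \<open>Shrinking \<open>V\<close> only lowers the number of edges inside it. Hence one
  decomposition for the largest admissible \<open>V\<close> serves all smaller ones.\<close>

lemma tight_mono:
  assumes "tight V E t" "W \<subseteq> V"
  shows "tight W E t"
proof -
  obtain Bs where Bs: "partition_on E Bs" "\<forall>B\<in>Bs. tight_block V B" "4 * card Bs = card E + t"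
    and fE: "finite E" using assms(1) by (auto simp: tight_def)
  have "tight_block W B" if "B \<in> Bs" for B
  proof -
    have "finite B" using fE Bs(1) that by (metis Union_upper finite_subset partition_onD1)
    then have "card {e \<in> B. e \<subseteq> W} \<le> card {e \<in> B. e \<subseteq> V}"
      using assms(2) by (intro card_mono) auto
    then show ?thesis using Bs(2) that by (auto simp: tight_block_def)
  qed
  then show ?thesis using Bs fE by (auto simp: tight_def)
qed

text \<open>An injective relabelling of vertices is injective on edges and on blocks, so every count
  survives. This carries explicit decompositions on natural numbers to arbitrary vertex
  sets.\<close>

lemma tight_image:
  assumes "tight V E t" "inj_on f X" "E \<subseteq> Pow X" "\<And>x. x \<in> X \<Longrightarrow> f x \<in> W \<longleftrightarrow> x \<in> V"
  shows "tight W ((`) f ` E) t"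
proof -
  obtain Bs where Bs: "partition_on E Bs" "\<forall>B\<in>Bs. tight_block V B" "4 * card Bs = card E + t"
    and fE: "finite E" using assms(1) by (auto simp: tight_def)
  have inj: "inj_on ((`) f) (Pow X)" using assms(2) by (rule inj_on_image_Pow)
  then have injE: "inj_on ((`) f) E" using assms(3) inj_on_subset by blast
  have part: "partition_on ((`) f ` E) ((`) ((`) f) ` Bs)"
    using partition_on_inj_image[OF Bs(1) injE] partition_onD3[OF Bs(1)] by (simp add: image_iff)
  have BsE: "Bs \<subseteq> Pow E" using Bs(1) by (auto simp: partition_on_def)
  then have cBs: "card ((`) ((`) f) ` Bs) = card Bs"
    by (intro card_image inj_on_subset[OF inj_on_image_Pow[OF injE]])
  have "tight_block W ((`) f ` B)" if "B \<in> Bs" for B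
  proof -
    have BX: "B \<subseteq> Pow X" "B \<subseteq> E" using that BsE assms(3) by auto
    then have injB: "inj_on ((`) f) B" using inj inj_on_subset by blast
    have U: "\<Union> ((`) f ` B) = f ` \<Union>B" by auto
    have "\<Union>B \<subseteq> X" using BX by auto
    then have "card (f ` \<Union>B) = card (\<Union>B)" by (intro card_image inj_on_subset[OF assms(2)])
    moreover have "f ` e \<subseteq> W \<longleftrightarrow> e \<subseteq> V" if "e \<in> B" for e
    proof -
      have "e \<subseteq> X" using that BX(1) by auto
      then show ?thesis using assms(4) unfolding image_subset_iff by blast
    qed
    then have "{e \<in> (`) f ` B. e \<subseteq> W} = (`) f ` {e \<in> B. e \<subseteq> V}"
      by auto
    moreover have "card ((`) f ` {e \<in> B. e \<subseteq> V}) = card {e \<in> B. e \<subseteq> V}"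
      by (intro card_image inj_on_subset[OF injB]) auto
    ultimately show ?thesis using Bs(2) that U card_image[OF injB]
      by (auto simp: tight_block_def)
  qed
  then show ?thesis using part cBs card_image[OF injE] Bs(3) fE
    unfolding tight_def by (intro conjI exI[of _ "(`) ((`) f) ` Bs"]) auto
qed

section \<open>Lower bounds and optimality\<close>

text \<open>With four or more vertices the bound on \<open>card B\<close> suffices; with
  \<open>k \<le> 3\<close> vertices there are at most \<open>k choose 2 \<le> k\<close>
  edges.\<close>

lemma card_le_card_Union:
  assumes "B \<subseteq> complete_edges X" "card B \<le> 4" "finite X"
  shows "card B \<le> card (\<Union>B)"
proof (cases "4 \<le> card (\<Union>B)")
  case False
  have "\<Union>B \<subseteq> X" using assms(1) by (auto simp: complete_edges_def)
  then have f: "finite (\<Union>B)" using assms(3) finite_subset by blast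
  have "B \<subseteq> {e. e \<subseteq> \<Union>B \<and> card e = 2}" using assms(1) by (auto simp: complete_edges_def)
  then have "card B \<le> card (\<Union>B) choose 2"
    using card_mono[of "{e. e \<subseteq> \<Union>B \<and> card e = 2}" B] f by (simp add: n_subsets)
  moreover have "card (\<Union>B) \<in> {0, 1, 2, 3}" using False by auto
  ultimately show ?thesis by (auto simp: numeral_eq_Suc)
qed (use assms in auto)

text \<open>Every grooming costs at least \<open>card ?E\<close> and has at least
  \<open>card ?E / 4\<close> blocks. A tight partition attains the first bound and, since
  \<open>t < 4\<close>, the second one rounded up. Both bounds ignore \<open>V\<close>, so the same
  partition is optimal with and without the condition on \<open>V\<close>.\<close>

lemma wavecost_eq_if_tight:
  assumes X: "finite X" and "tight V (complete_edges X) t" "t < 4"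
  shows "wavecost_MON2 X V 4 2 = wavecost_MON X 4"
proof -
  let ?E = "complete_edges X"
  obtain Bs where Bs: "partition_on ?E Bs" "\<forall>B\<in>Bs. tight_block V B" "4 * card Bs = card ?E + t"
    using assms(2) by (auto simp: tight_def)
  have fE: "finite ?E" using X by (rule finite_complete_edges)
  have size: "card ?E = (\<Sum>B\<in>Cs. card B)" if "grooming X 4 Cs" for Cs
  proof -
    have Cs: "partition_on ?E Cs" using that by (simp add: grooming_def)
    have "\<forall>B\<in>Cs. finite B" using fE Cs by (metis Union_upper finite_subset partition_onD1)
    then have "card (\<Union>Cs) = sum card Cs"
      using partition_onD2[OF Cs] by (intro card_Union_disjoint) (auto simp: disjoint_def pairwise_def)
    then show ?thesis using partition_onD1[OF Cs] by simp
  qed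
  have cost: "card ?E \<le> drop_cost Cs" if "grooming X 4 Cs" for Cs
    unfolding size[OF that] drop_cost_def
  proof (rule sum_mono)
    fix B assume "B \<in> Cs"
    then have "B \<subseteq> ?E" "card B \<le> 4" using that by (auto simp: grooming_def partition_on_def)
    then show "card B \<le> card (\<Union>B)" using X by (rule card_le_card_Union)
  qed
  have waves: "card ?E \<le> 4 * card Cs" if "grooming X 4 Cs" for Cs
    unfolding size[OF that]
    using sum_bounded_above[of Cs card 4] that by (auto simp: grooming_def mult.commute)
  have g2: "grooming2 X V 4 2 Bs"
    using Bs by (auto simp: grooming2_def grooming_def tight_block_def)
  then have g: "grooming X 4 Bs" by (simp add: grooming2_def)
  have dc: "drop_cost Bs = card ?E"
    unfolding size[OF g] drop_cost_def using Bs(2) by (intro sum.cong) (auto simp: tight_block_def)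
  have ON: "ON X 4 Bs" using g cost dc by (simp add: ON_def is_arg_min_linorder)
  have ON2: "ON2 X V 4 2 Bs"
    using g2 cost dc by (simp add: ON2_def grooming2_def is_arg_min_linorder)
  have min: "card Bs \<le> card Cs" if "grooming X 4 Cs" for Cs
    using waves[OF that] Bs(3) assms(3) by linarith
  have "MON X 4 Bs"
    using ON min by (simp add: MON_def ON_def is_arg_min_linorder)
  moreover have "MON2 X V 4 2 Bs"
    using ON2 min by (simp add: MON2_def ON2_def grooming2_def is_arg_min_linorder)
  ultimately show ?thesis using card_MON[of X 4 Bs] card_MON2[of X V 4 2 Bs] by simp
qed

text \<open>At most one edge fits inside \<open>V\<close>, so both kinds of groomings
  coincide.\<close>

lemma wavecost_eq_if_card_le_2:
  assumes "finite V" "card V \<le> 2"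
  shows "wavecost_MON2 X V 4 2 = wavecost_MON X 4"
proof -
  have le: "card {e \<in> B. e \<subseteq> V} \<le> 2" if "partition_on (complete_edges X) Bs" "B \<in> Bs" for Bs B
  proof -
    \<comment> \<open>An edge has two vertices, so an edge inside \<open>V\<close> is
      \<open>V\<close> itself.\<close>
    have "{e \<in> B. e \<subseteq> V} \<subseteq> {V}"
    proof
      fix e assume "e \<in> {e \<in> B. e \<subseteq> V}"
      then have "e \<subseteq> V" "card e = 2" using that by (auto simp: partition_on_def complete_edges_def)
      then show "e \<in> {V}" using assms by (simp add: card_seteq)
    qed
    then have "card {e \<in> B. e \<subseteq> V} \<le> card {V}" by (intro card_mono) auto
    then show ?thesis by simp
  qed
  then have "grooming2 X V 4 2 = grooming X 4"
    unfolding fun_eq_iff grooming2_def grooming_def by blast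
  then have "ON2 X V 4 2 = ON X 4" by (intro ext) (simp only: ON2_def ON_def)
  then show ?thesis
    by (simp add: wavecost_MON2_def wavecost_MON_def MON2_def MON_def)
qed

subsection \<open>Explicit decompositions\<close>

text \<open>\<open>Paw a b c d\<close> is the triangle \<open>a b c\<close> with the pendant edge \<open>a d\<close>; the vertices in \<open>V\<close> are the
  numbers below \<open>v\<close>.\<close>

datatype block = Tri nat nat nat | Cyc nat nat nat nat | Paw nat nat nat nat

fun corners :: "block \<Rightarrow> nat list" where
  "corners (Tri a b c) = [a, b, c]"
| "corners (Cyc a b c d) = [a, b, c, d]"
| "corners (Paw a b c d) = [a, b, c, d]"

text \<open>Ordered pairs stand for edges so that evaluation compares numbers instead of sets;
  putting the smaller end first makes the representation unique.\<close>

definition arc :: "nat \<Rightarrow> nat \<Rightarrow> nat \<times> nat" where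
  "arc i j = (if i < j then (i, j) else (j, i))"

fun arcs :: "block \<Rightarrow> (nat \<times> nat) list" where
  "arcs (Tri a b c) = [arc a b, arc b c, arc a c]"
| "arcs (Cyc a b c d) = [arc a b, arc b c, arc c d, arc a d]"
| "arcs (Paw a b c d) = [arc a b, arc b c, arc a c, arc a d]"

definition valid_block :: "nat \<Rightarrow> block \<Rightarrow> bool" where
  "valid_block v b \<longleftrightarrow> distinct (corners b) \<and>
     length (filter (\<lambda>(i, j). i < v \<and> j < v) (arcs b)) \<le> 2"

text \<open>Equality of sorted lists, column by column, checks at once that every wanted pair
  occurs, that none occurs twice and that no other pair ends in \<open>j\<close>. The last conjunct
  excludes columns from \<open>n\<close> on.\<close>

definition lists_arcs :: "nat \<Rightarrow> (nat \<Rightarrow> nat \<Rightarrow> bool) \<Rightarrow> (nat \<times> nat) list \<Rightarrow> bool" where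
  "lists_arcs n P ps \<longleftrightarrow>
     (\<forall>j\<in>set [0..<n]. sort (map fst (filter (\<lambda>p. snd p = j) ps)) = filter (\<lambda>i. P i j) [0..<j]) \<and>
     (\<forall>p\<in>set ps. snd p < n)"

text \<open>Blocks have three or four edges, so the sum counts the triangles.\<close>

definition certificate ::
  "nat \<Rightarrow> nat \<Rightarrow> (nat \<Rightarrow> nat \<Rightarrow> bool) \<Rightarrow> block list \<Rightarrow> nat \<Rightarrow> bool" where
  "certificate n v P bs t \<longleftrightarrow> list_all (valid_block v) bs \<and>
     lists_arcs n P (concat (map arcs bs)) \<and> sum_list (map (\<lambda>b. 4 - length (arcs b)) bs) = t"

definition edge :: "nat \<times> nat \<Rightarrow> nat set" where
  "edge p = {fst p, snd p}"

lemma edge_arc [simp]: "edge (arc i j) = {i, j}"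
  by (auto simp: edge_def arc_def)

text \<open>Equal entries lie in the same fibre of \<open>f\<close>, so repetitions can be excluded
  fibre by fibre.\<close>

lemma distinct_if_distinct_filter:
  assumes "\<And>j. distinct (filter (\<lambda>x. f x = j) xs)"
  shows "distinct xs"
  using assms
proof (induction xs)
  case (Cons x xs)
  have "distinct (filter (\<lambda>y. f y = j) xs)" for j
    using Cons.prems[of j] by (simp split: if_splits)
  then show ?case using Cons.IH Cons.prems[of "f x"] by simp
qed simp

lemma lists_arcsD:
  assumes "lists_arcs n P ps"
  shows "distinct ps" and "set ps = {(i, j). i < j \<and> j < n \<and> P i j}"
proof -
  have bound: "snd p < n" if "p \<in> set ps" for p using assms that by (simp add: lists_arcs_def)
  have sort: "sort (map fst (filter (\<lambda>p. snd p = j) ps)) = filter (\<lambda>i. P i j) [0..<j]" if "j < n" for j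
    using assms that by (simp add: lists_arcs_def)
  have "distinct (filter (\<lambda>p. snd p = j) ps)" for j
  proof (cases "j < n")
    case True
    have "distinct (sort (map fst (filter (\<lambda>p. snd p = j) ps)))" unfolding sort[OF True] by simp
    then show ?thesis by (simp add: distinct_map)
  next
    case False
    then have "filter (\<lambda>p. snd p = j) ps = []" using bound by (auto simp: filter_empty_conv)
    then show ?thesis by simp
  qed
  then show "distinct ps" by (rule distinct_if_distinct_filter)
  have "(i, j) \<in> set ps \<longleftrightarrow> i < j \<and> P i j" if "j < n" for i j
  proof -
    have "(i, j) \<in> set ps \<longleftrightarrow> i \<in> set (sort (map fst (filter (\<lambda>p. snd p = j) ps)))" by force
    then show ?thesis unfolding sort[OF that] by auto
  qed
  then show "set ps = {(i, j). i < j \<and> j < n \<and> P i j}" using bound by fastforce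
qed

lemma inj_on_edge: "inj_on edge {(i, j). i < j}"
  by (auto simp: inj_on_def edge_def doubleton_eq_iff)

lemma arcs_ordered: "distinct (corners b) \<Longrightarrow> set (arcs b) \<subseteq> {(i, j). i < j}"
  by (cases b) (auto simp: arc_def split: if_splits)

text \<open>Each of the three shapes has as many corners as arcs, and distinct arcs give distinct
  edges by \<open>inj_on_edge\<close>.\<close>

lemma tight_arcs:
  assumes "valid_block v b" "distinct (arcs b)"
  shows "tight {..<v} (edge ` set (arcs b)) (4 - length (arcs b))"
proof -
  let ?B = "edge ` set (arcs b)"
  have d: "distinct (corners b)" using assms(1) by (simp add: valid_block_def)
  have "inj_on edge (set (arcs b))" using inj_on_edge arcs_ordered[OF d] by (rule inj_on_subset)
  then have card: "card ?B = length (arcs b)"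
    using assms(2) by (simp add: card_image distinct_card)
  have "\<Union> ?B = set (corners b)" by (cases b) auto
  then have "card (\<Union> ?B) = length (corners b)" using d by (simp add: distinct_card)
  moreover have "length (corners b) = length (arcs b)" by (cases b) auto
  moreover have "card {e \<in> ?B. e \<subseteq> {..<v}} \<le> 2"
  proof -
    let ?F = "filter (\<lambda>(i, j). i < v \<and> j < v) (arcs b)"
    have "edge p \<subseteq> {..<v} \<longleftrightarrow> (case p of (i, j) \<Rightarrow> i < v \<and> j < v)" for p
      by (simp add: edge_def split: prod.split)
    then have "{e \<in> ?B. e \<subseteq> {..<v}} = edge ` set ?F" by auto
    then have "card {e \<in> ?B. e \<subseteq> {..<v}} \<le> length ?F"
      using card_image_le[of "set ?F" edge] card_length[of ?F] by simp
    then show ?thesis using assms(1) by (simp add: valid_block_def)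
  qed
  moreover have "3 \<le> length (arcs b)" "length (arcs b) \<le> 4" by (cases b; simp)+
  ultimately show ?thesis
    using card by (intro tight_single) (auto simp: tight_block_def)
qed

lemma tight_blocks:
  assumes "list_all (valid_block v) bs" "distinct (concat (map arcs bs))"
  shows "tight {..<v} (edge ` set (concat (map arcs bs))) (sum_list (map (\<lambda>b. 4 - length (arcs b)) bs))"
  using assms
proof (induction bs)
  case Nil
  then show ?case by (simp add: tight_empty)
next
  case (Cons b bs)
  let ?p = "set (arcs b)" and ?q = "set (concat (map arcs bs))"
  \<comment> \<open>On increasing pairs \<open>edge\<close> is injective, so disjoint sets of arcs
    yield disjoint sets of edges.\<close>
  have "?p \<union> ?q \<subseteq> {(i, j). i < j}"
    using Cons.prems(1) arcs_ordered by (fastforce simp: list_all_iff valid_block_def)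
  then have "edge ` ?p \<inter> edge ` ?q = edge ` (?p \<inter> ?q)"
    using inj_on_image_Int[OF inj_on_edge, of ?p ?q] by simp
  then have "edge ` ?p \<inter> edge ` ?q = {}" using Cons.prems(2) by simp
  moreover have "tight {..<v} (edge ` ?p) (4 - length (arcs b))"
    using Cons.prems by (intro tight_arcs) auto
  moreover have "tight {..<v} (edge ` ?q) (sum_list (map (\<lambda>b. 4 - length (arcs b)) bs))"
    using Cons by auto
  ultimately show ?case
    using tight_Un[of "{..<v}" "edge ` ?p" _ "edge ` ?q"] by (simp add: image_Un)
qed

lemma tight_certificate:
  assumes "certificate n v P bs t" "E = {{i, j} | i j. i < j \<and> j < n \<and> P i j}"
  shows "tight {..<v} E t"
proof -
  have c: "list_all (valid_block v) bs" "lists_arcs n P (concat (map arcs bs))"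
    "sum_list (map (\<lambda>b. 4 - length (arcs b)) bs) = t"
    using assms(1) by (auto simp: certificate_def)
  have "E = edge ` set (concat (map arcs bs))"
  proof -
    have "edge ` {(i, j). Q i j} = {edge (i, j) | i j. Q i j}" for Q :: "nat \<Rightarrow> nat \<Rightarrow> bool" by blast
    then show ?thesis unfolding lists_arcsD(2)[OF c(2)] assms(2) by (simp add: edge_def)
  qed
  then show ?thesis using tight_blocks[OF c(1) lists_arcsD(1)[OF c(2)]] c(3) by simp
qed

section \<open>Complete and complete bipartite graphs as edge sets\<close>

text \<open>For disjoint \<open>A\<close> and \<open>B\<close> this is the complete bipartite graph
  between them.\<close>

definition cross_edges :: "'a set \<Rightarrow> 'a set \<Rightarrow> 'a set set" where
  "cross_edges A B = (\<lambda>(a, b). {a, b}) ` (A \<times> B)"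

lemma mem_complete_edges:
  "e \<in> complete_edges X \<longleftrightarrow> (\<exists>i\<in>X. \<exists>j\<in>X. i \<noteq> j \<and> e = {i, j})"
  unfolding complete_edges_def mem_Collect_eq card_2_iff by (metis empty_subsetI insert_subset)

lemma doubleton_in_complete_edges [simp]:
  "{i, j} \<in> complete_edges X \<longleftrightarrow> i \<in> X \<and> j \<in> X \<and> i \<noteq> j"
  by (auto simp: complete_edges_def card_2_iff)

text \<open>Every edge has a unique increasing representation, so a set of edges is determined by
  its members \<open>{i, j}\<close> with \<open>i < j\<close>. This matches the form required by
  \<open>tight_certificate\<close>.\<close>

lemma ordered_doubletons_eqI:
  fixes F :: "nat set set"
  assumes "F \<subseteq> complete_edges {..<n}" "\<And>i j. i < j \<Longrightarrow> j < n \<Longrightarrow> {i, j} \<in> F \<longleftrightarrow> P i j"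
  shows "F = {{i, j} | i j. i < j \<and> j < n \<and> P i j}"
proof (rule subset_antisym)
  show "F \<subseteq> {{i, j} | i j. i < j \<and> j < n \<and> P i j}"
  proof
    fix e assume e: "e \<in> F"
    then obtain i j where ij: "i < n" "j < n" "i \<noteq> j" "e = {i, j}"
      using assms(1) mem_complete_edges[of e "{..<n}"] by auto
    then have "\<exists>i j. i < j \<and> j < n \<and> e = {i, j}"
      by (metis insert_commute linorder_neqE_nat)
    then obtain i' j' where "i' < j'" "j' < n" "e = {i', j'}" by blast
    then show "e \<in> {{i, j} | i j. i < j \<and> j < n \<and> P i j}" using e assms(2) by blast
  qed
  show "{{i, j} | i j. i < j \<and> j < n \<and> P i j} \<subseteq> F" using assms(2) by blast
qed

lemma tight_certificate_hole:
  assumes "certificate n v (\<lambda>i j. \<not> (i \<in> set hs \<and> j \<in> set hs)) bs t"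
  shows "tight {..<v} (complete_edges {..<n} - complete_edges (set hs)) t"
  by (rule tight_certificate[OF assms], rule ordered_doubletons_eqI) auto

lemma cross_edgesE:
  assumes "e \<in> cross_edges A B"
  obtains a b where "a \<in> A" "b \<in> B" "e = {a, b}"
  using assms by (auto simp: cross_edges_def)

lemma mem_cross_edges:
  "{i, j} \<in> cross_edges A B \<longleftrightarrow> i \<in> A \<and> j \<in> B \<or> j \<in> A \<and> i \<in> B"
  by (auto simp: cross_edges_def image_iff doubleton_eq_iff)

lemma tight_certificate_cross:
  assumes "certificate n v (\<lambda>i j. i \<in> set as \<longleftrightarrow> j \<notin> set as) bs t" "set as \<subseteq> {..<n}"
  shows "tight {..<v} (cross_edges (set as) ({..<n} - set as)) t"
proof (rule tight_certificate[OF assms(1)], rule ordered_doubletons_eqI)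
  show "cross_edges (set as) ({..<n} - set as) \<subseteq> complete_edges {..<n}"
    using assms(2) by (auto elim!: cross_edgesE)
qed (use assms(2) in \<open>auto simp: mem_cross_edges\<close>)

subsection \<open>Edges between two vertex sets\<close>

text \<open>The fibres of the two labellings have equal sizes; bijections between corresponding
  fibres are glued together.\<close>

lemma ex_bij_betw_label_preserving:
  assumes "finite A" "finite B" "\<And>l. card {x \<in> A. g x = l} = card {y \<in> B. h y = l}"
  shows "\<exists>f. bij_betw f A B \<and> (\<forall>x\<in>A. h (f x) = g x)"
proof -
  have "\<exists>f. bij_betw f {x \<in> A. g x = l} {y \<in> B. h y = l}" for l
    using assms by (intro finite_same_card_bij) auto
  then obtain F where F: "\<And>l. bij_betw (F l) {x \<in> A. g x = l} {y \<in> B. h y = l}" by metis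
  define f where "f x = F (g x) x" for x
  have f: "f x \<in> B" "h (f x) = g x" if "x \<in> A" for x
    using bij_betwE[OF F[of "g x"]] that by (auto simp: f_def)
  have "inj_on f A"
  proof (rule inj_onI)
    fix x y assume xy: "x \<in> A" "y \<in> A" "f x = f y"
    then have "g x = g y" using f(2) by metis
    then show "x = y"
      using bij_betw_imp_inj_on[OF F[of "g x"]] xy by (auto simp: f_def inj_on_def)
  qed
  moreover have "y \<in> f ` A" if "y \<in> B" for y
  proof -
    have "y \<in> F (h y) ` {x \<in> A. g x = h y}" using F[of "h y"] that by (auto simp: bij_betw_def)
    then obtain x where "x \<in> A" "g x = h y" "y = F (h y) x" by auto
    then have "y = f x" by (simp add: f_def)
    then show ?thesis using \<open>x \<in> A\<close> by simp
  qed
  ultimately show ?thesis using f by (intro exI[of _ f]) (auto simp: bij_betw_def)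
qed

text \<open>Labelling each vertex by its membership in \<open>V\<close> and in \<open>A\<close>
  gives four classes, and the four cardinality hypotheses match them.\<close>

lemma ex_inj_on_two_sets:
  assumes "finite A" "finite B" "A \<inter> B = {}" "finite C" "finite D" "C \<inter> D = {}"
    and "card (A \<inter> V) = card (C \<inter> W)" "card (A - V) = card (C - W)"
    and "card (B \<inter> V) = card (D \<inter> W)" "card (B - V) = card (D - W)"
  shows "\<exists>f. inj_on f (A \<union> B) \<and> f ` A = C \<and> f ` B = D \<and> (\<forall>x\<in>A \<union> B. f x \<in> W \<longleftrightarrow> x \<in> V)"
proof -
  have split: "{x \<in> S \<union> T. (x \<in> U, x \<in> S) = (p, q)} =
      (if q then if p then S \<inter> U else S - U else if p then T \<inter> U else T - U)"
    if "S \<inter> T = {}" for S T U :: "'c set" and p q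
    using that by (cases p; cases q) auto
  have "card {x \<in> A \<union> B. (x \<in> V, x \<in> A) = l} = card {y \<in> C \<union> D. (y \<in> W, y \<in> C) = l}" for l
    using split[OF assms(3), of V "fst l" "snd l"] split[OF assms(6), of W "fst l" "snd l"] assms(7-10)
    by simp
  then obtain f where f: "bij_betw f (A \<union> B) (C \<union> D)"
      "\<forall>x\<in>A \<union> B. (f x \<in> W, f x \<in> C) = (x \<in> V, x \<in> A)"
    using ex_bij_betw_label_preserving[of "A \<union> B" "C \<union> D" "\<lambda>x. (x \<in> V, x \<in> A)" "\<lambda>y. (y \<in> W, y \<in> C)"]
      assms by auto
  have onto: "f ` (A \<union> B) = C \<union> D" using f(1) by (simp add: bij_betw_def)
  have C: "f x \<in> C \<longleftrightarrow> x \<in> A" if "x \<in> A \<union> B" for x using f(2) that by auto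
  have D: "f x \<in> D \<longleftrightarrow> x \<in> B" if "x \<in> A \<union> B" for x
    using C[OF that] that onto assms(3,6) by blast
  have "f ` A = C" "f ` B = D"
    using C D onto by (auto 0 3 simp: set_eq_iff image_iff)
  then show ?thesis using f by (auto simp: bij_betw_def)
qed

lemma image_complete_edges:
  assumes "inj_on f X"
  shows "(`) f ` complete_edges X = complete_edges (f ` X)"
proof (intro set_eqI iffI)
  fix e assume "e \<in> (`) f ` complete_edges X"
  then obtain i j where "i \<in> X" "j \<in> X" "i \<noteq> j" "e = f ` {i, j}"
    using mem_complete_edges by (metis imageE)
  then show "e \<in> complete_edges (f ` X)" using assms by (simp add: inj_on_eq_iff)
next
  fix e assume "e \<in> complete_edges (f ` X)"
  then obtain i j where "i \<in> X" "j \<in> X" "f i \<noteq> f j" "e = {f i, f j}"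
    by (auto simp: mem_complete_edges)
  then have "{i, j} \<in> complete_edges X" "e = f ` {i, j}" by auto
  then show "e \<in> (`) f ` complete_edges X" by blast
qed

lemma complete_edges_mono: "X \<subseteq> Y \<Longrightarrow> complete_edges X \<subseteq> complete_edges Y"
  by (auto simp: complete_edges_def)

lemma complete_edges_Pow: "complete_edges X \<subseteq> Pow X"
  by (auto simp: complete_edges_def)

lemma image_cross_edges: "(`) f ` cross_edges A B = cross_edges (f ` A) (f ` B)"
proof (intro set_eqI iffI)
  fix e assume "e \<in> cross_edges (f ` A) (f ` B)"
  then obtain a b where "a \<in> A" "b \<in> B" "e = f ` {a, b}" by (auto elim!: cross_edgesE)
  then show "e \<in> (`) f ` cross_edges A B"
    by (intro image_eqI[of _ _ "{a, b}"]) (simp_all add: mem_cross_edges)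
next
  fix e assume "e \<in> (`) f ` cross_edges A B"
  then obtain a b where "a \<in> A" "b \<in> B" "e = {f a, f b}" by (auto elim!: cross_edgesE)
  then show "e \<in> cross_edges (f ` A) (f ` B)" by (simp add: mem_cross_edges)
qed

text \<open>Whether such a decomposition exists depends only on how many vertices of the hole and of
  the rest lie inside and outside \<open>V\<close>.\<close>

lemma tight_hole_transfer:
  assumes "tight V (complete_edges (H \<union> A) - complete_edges H) t"
    and "finite H" "finite A" "H \<inter> A = {}" "finite H'" "finite A'" "H' \<inter> A' = {}"
    and "card (H \<inter> V) = card (H' \<inter> V')" "card (H - V) = card (H' - V')"
    and "card (A \<inter> V) = card (A' \<inter> V')" "card (A - V) = card (A' - V')"
  shows "tight V' (complete_edges (H' \<union> A') - complete_edges H') t"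
proof -
  obtain f where f: "inj_on f (H \<union> A)" "f ` H = H'" "f ` A = A'"
      "\<forall>x\<in>H \<union> A. f x \<in> V' \<longleftrightarrow> x \<in> V"
    using ex_inj_on_two_sets[OF assms(2-)] by blast
  have sub: "complete_edges H \<subseteq> complete_edges (H \<union> A)" by (rule complete_edges_mono) simp
  have injH: "inj_on f H" using f(1) by (rule inj_on_subset) simp
  have "(`) f ` (complete_edges (H \<union> A) - complete_edges H)
      = (`) f ` complete_edges (H \<union> A) - (`) f ` complete_edges H"
    by (rule inj_on_image_set_diff[OF inj_on_image_Pow[OF f(1)]])
      (use complete_edges_Pow sub in blast)+
  also have "\<dots> = complete_edges (H' \<union> A') - complete_edges H'"
    unfolding image_complete_edges[OF f(1)] image_complete_edges[OF injH] image_Un f(2,3) by (rule refl)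
  finally have image: "(`) f ` (complete_edges (H \<union> A) - complete_edges H)
      = complete_edges (H' \<union> A') - complete_edges H'" .
  have "complete_edges (H \<union> A) - complete_edges H \<subseteq> Pow (H \<union> A)"
    using complete_edges_Pow by blast
  from tight_image[OF assms(1) f(1) this, of V'] show ?thesis
    unfolding image using f(4) by blast
qed

lemma tight_cross_transfer:
  assumes "tight V (cross_edges A B) t"
    and "finite A" "finite B" "A \<inter> B = {}" "finite A'" "finite B'" "A' \<inter> B' = {}"
    and "card (A \<inter> V) = card (A' \<inter> V')" "card (A - V) = card (A' - V')"
    and "card (B \<inter> V) = card (B' \<inter> V')" "card (B - V) = card (B' - V')"
  shows "tight V' (cross_edges A' B') t"
proof -
  obtain f where f: "inj_on f (A \<union> B)" "f ` A = A'" "f ` B = B'"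
      "\<forall>x\<in>A \<union> B. f x \<in> V' \<longleftrightarrow> x \<in> V"
    using ex_inj_on_two_sets[OF assms(2-)] by blast
  have "cross_edges A B \<subseteq> Pow (A \<union> B)" by (auto elim!: cross_edgesE)
  then show ?thesis
    using tight_image[OF assms(1) f(1)] f(2-4) by (simp add: image_cross_edges)
qed

lemma cross_edges_commute: "cross_edges A B = cross_edges B A"
proof -
  have sub: "cross_edges A B \<subseteq> cross_edges B A" for A B :: "'a set"
  proof
    fix e assume "e \<in> cross_edges A B"
    then show "e \<in> cross_edges B A"
      by (rule cross_edgesE) (simp add: mem_cross_edges)
  qed
  show ?thesis using sub[of A B] sub[of B A] by (rule subset_antisym)
qed

lemma cross_edges_empty [simp]: "cross_edges A {} = {}" "cross_edges {} B = {}"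
  by (auto simp: cross_edges_def)

lemma tight_cross_Un:
  assumes "tight V (cross_edges A C) s" "tight V (cross_edges B C) t"
    and "A \<inter> B = {}" "(A \<union> B) \<inter> C = {}"
  shows "tight V (cross_edges (A \<union> B) C) (s + t)"
proof -
  have "cross_edges (A \<union> B) C = cross_edges A C \<union> cross_edges B C"
    by (simp add: cross_edges_def Sigma_Un_distrib1 image_Un)
  moreover have "cross_edges A C \<inter> cross_edges B C = {}"
  proof (rule equals0I)
    fix e assume "e \<in> cross_edges A C \<inter> cross_edges B C"
    then obtain a c where "a \<in> A" "c \<in> C" "{a, c} \<in> cross_edges B C"
      by (metis IntE cross_edgesE)
    then show False using assms(3,4) by (auto simp: mem_cross_edges)
  qed
  ultimately show ?thesis using tight_Un[OF assms(1,2)] by simp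
qed

section \<open>Splitting bipartite graphs into 4-cycles\<close>

text \<open>The edges form the 4-cycle \<open>p x q y\<close>. The two edges at \<open>y\<close>
  leave \<open>V\<close>, so at most two lie inside it, wherever \<open>p\<close> and
  \<open>q\<close> are.\<close>

lemma tight_rectangle:
  assumes "x \<in> V" "y \<notin> V" "p \<noteq> q" "{p, q} \<inter> {x, y} = {}"
  shows "tight V (cross_edges {p, q} {x, y}) 0"
proof (rule tight_single)
  let ?B = "{{p, x}, {p, y}, {q, x}, {q, y}}"
  have B: "cross_edges {p, q} {x, y} = ?B" by (auto simp: cross_edges_def)
  have xy: "x \<noteq> y" using assms(1,2) by auto
  have card: "card ?B = 4"
    using assms(3,4) xy by (auto simp: doubleton_eq_iff card_insert_if)
  moreover have "card (\<Union>?B) = 4" using assms(3,4) xy by (auto simp: card_insert_if)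
  moreover have "card {e \<in> ?B. e \<subseteq> V} \<le> card {{p, x}, {q, x}}"
    using assms(2) by (intro card_mono) auto
  then have "card {e \<in> ?B. e \<subseteq> V} \<le> 2" using card_insert_le_m1[of 2 "{{q, x}}" "{p, x}"] by simp
  ultimately show "tight_block V (cross_edges {p, q} {x, y})" by (simp add: B tight_block_def)
  show "card (cross_edges {p, q} {x, y}) + 0 = 4" using card B by simp
qed (auto simp: cross_edges_def)

text \<open>Pairing up the vertices of the even set \<open>A\<close> arbitrarily leaves one
  rectangle per pair.\<close>

lemma tight_cross_pair:
  assumes "finite A" "card A = 2 * m" "x \<in> V" "y \<notin> V" "A \<inter> {x, y} = {}"
  shows "tight V (cross_edges A {x, y}) 0"
  using assms
proof (induction m arbitrary: A)
  case 0
  then show ?case by (simp add: tight_empty)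
next
  case (Suc m)
  have "2 \<le> card A" using Suc.prems(2) by simp
  then obtain P where P: "P \<subseteq> A" "card P = 2" "finite P" by (rule obtain_subset_with_card_n)
  then obtain p q where pq: "P = {p, q}" "p \<noteq> q" by (auto simp: card_2_iff)
  have "tight V (cross_edges (A - P) {x, y}) 0"
  proof (rule Suc.IH)
    show "card (A - P) = 2 * m" using Suc.prems P by (simp add: card_Diff_subset)
  qed (use Suc.prems in auto)
  moreover have "tight V (cross_edges P {x, y}) 0"
    unfolding pq(1) using Suc.prems(3-5) P(1) pq by (intro tight_rectangle) auto
  ultimately have "tight V (cross_edges (P \<union> (A - P)) {x, y}) (0 + 0)"
    using Suc.prems(5) P(1) by (intro tight_cross_Un) auto
  then show ?case using P(1) by (simp add: Un_absorb1)
qed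

lemma split_set:
  assumes "finite B" "card (B \<inter> V) = m + p" "card (B - V) = n + q"
  obtains C D where "B = C \<union> D" "C \<inter> D = {}" "card (C \<inter> V) = m" "card (C - V) = n"
    "card (D \<inter> V) = p" "card (D - V) = q"
proof -
  have "m \<le> card (B \<inter> V)" "n \<le> card (B - V)" using assms by simp_all
  then obtain S T where S: "S \<subseteq> B \<inter> V" "card S = m" "finite S"
    and T: "T \<subseteq> B - V" "card T = n" "finite T"
    by (meson obtain_subset_with_card_n)
  show thesis
  proof
    show "B = (S \<union> T) \<union> (B - (S \<union> T))" "(S \<union> T) \<inter> (B - (S \<union> T)) = {}" using S T by auto
    have "(S \<union> T) \<inter> V = S" "(S \<union> T) - V = T" using S T by auto
    then show "card ((S \<union> T) \<inter> V) = m" "card ((S \<union> T) - V) = n" using S T by auto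
    have "(B - (S \<union> T)) \<inter> V = B \<inter> V - S" "B - (S \<union> T) - V = B - V - T" using S T by auto
    then show "card ((B - (S \<union> T)) \<inter> V) = p" "card (B - (S \<union> T) - V) = q"
      using S T assms by (simp_all add: card_Diff_subset)
  qed
qed

lemma card_split: "finite A \<Longrightarrow> card A = card (A \<inter> V) + card (A - V)"
  by (metis Int_Diff_Un card_Un_disjoint finite_Diff finite_Int Int_Diff_disjoint)

lemma empty_if_card_parts: "finite A \<Longrightarrow> card (A \<inter> V) = 0 \<Longrightarrow> card (A - V) = 0 \<Longrightarrow> A = {}"
  by auto

text \<open>Both sides have four vertices in \<open>V\<close> and two outside. Of the 36 edges 16
  lie inside \<open>V\<close>, and the nine 4-cycles together allow 18 such edges.\<close>

lemma cross_certificate: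
  "certificate 12 8 (\<lambda>i j. i \<in> set [0, 1, 2, 3, 8, 9] \<longleftrightarrow> j \<notin> set [0, 1, 2, 3, 8, 9])
    [Cyc 0 4 1 10, Cyc 2 6 3 10, Cyc 0 5 1 11, Cyc 2 7 3 11, Cyc 0 6 8 7, Cyc 1 6 9 7,
     Cyc 2 4 8 5, Cyc 3 4 9 5, Cyc 8 10 9 11] 0"
  by code_simp

lemma tight_cross_six_six:
  assumes "finite A" "finite B" "A \<inter> B = {}" "card (A \<inter> V) = 4" "card (A - V) = 2"
    "card (B \<inter> V) = 4" "card (B - V) = 2"
  shows "tight V (cross_edges A B) 0"
proof -
  let ?A = "{0, 1, 2, 3, 8, 9::nat}"
  have "{..<12} - ?A = {4, 5, 6, 7, 10, 11::nat}"
    by (auto simp: lessThan_nat_numeral)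
  moreover have "?A \<inter> {..<8} = {0, 1, 2, 3}" "?A - {..<8} = {8, 9}"
    "{4, 5, 6, 7, 10, 11::nat} \<inter> {..<8} = {4, 5, 6, 7}" "{4, 5, 6, 7, 10, 11::nat} - {..<8} = {10, 11}"
    by auto
  ultimately show ?thesis
    using tight_cross_transfer[OF tight_certificate_cross[OF cross_certificate], of A B V] assms
    by simp
qed

text \<open>Two inductions consume \<open>B\<close>: the outer one removes sets with four vertices
  in \<open>V\<close> and two outside, treated by \<open>tight_cross_six_six\<close>; the inner one
  removes pairs with one vertex on each side of \<open>V\<close>, treated by
  \<open>tight_cross_pair\<close>.\<close>

lemma tight_cross_six:
  assumes A: "finite A" "card (A \<inter> V) = 4" "card (A - V) = 2"
    and B: "finite B" "card (B \<inter> V) = 4 * c + d" "card (B - V) = 2 * c + d" "A \<inter> B = {}"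
  shows "tight V (cross_edges B A) 0"
  using B
proof (induction c arbitrary: B)
  case 0
  then show ?case
  proof (induction d arbitrary: B)
    case 0
    then have "B = {}" using empty_if_card_parts[of B V] by simp
    then show ?case by (simp add: tight_empty)
  next
    case (Suc d)
    have "card (B \<inter> V) = 1 + d" "card (B - V) = 1 + d" using Suc.prems(2,3) by simp_all
    with Suc.prems(1) obtain C D where CD: "B = C \<union> D" "C \<inter> D = {}"
      "card (C \<inter> V) = 1" "card (C - V) = 1" "card (D \<inter> V) = d" "card (D - V) = d"
      by (rule split_set)
    from CD(3,4) obtain x y where "C \<inter> V = {x}" "C - V = {y}" by (metis card_1_singletonE)
    then have xy: "x \<in> V" "y \<notin> V" "C = {x, y}" by auto
    have disj: "A \<inter> {x, y} = {}" "A \<inter> D = {}" using Suc.prems(4) CD(1) xy(3) by auto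
    \<comment> \<open>\<open>tight_cross_pair\<close> asks for a set of even size.\<close>
    have "card A = 2 * 3" using card_split[OF A(1), of V] A(2,3) by simp
    then have "tight V (cross_edges A {x, y}) 0"
      using A(1) xy(1,2) disj(1) by (intro tight_cross_pair)
    then have "tight V (cross_edges C A) 0" unfolding xy(3) by (subst cross_edges_commute)
    moreover have "tight V (cross_edges D A) 0"
      using Suc.prems(1) CD disj(2) by (intro Suc.IH) auto
    ultimately have "tight V (cross_edges (C \<union> D) A) (0 + 0)"
      using Suc.prems(4) CD(1,2) by (intro tight_cross_Un) auto
    then show ?case by (simp add: CD(1))
  qed
next
  case (Suc c)
  have "card (B \<inter> V) = 4 + (4 * c + d)" "card (B - V) = 2 + (2 * c + d)"
    using Suc.prems(2,3) by simp_all
  with Suc.prems(1) obtain C D where CD: "B = C \<union> D" "C \<inter> D = {}"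
    "card (C \<inter> V) = 4" "card (C - V) = 2" "card (D \<inter> V) = 4 * c + d" "card (D - V) = 2 * c + d"
    by (rule split_set)
  have "tight V (cross_edges C A) 0"
    using A CD Suc.prems(1,4) by (intro tight_cross_six_six) auto
  moreover have "tight V (cross_edges D A) 0"
    using Suc.prems(1,4) CD by (intro Suc.IH) auto
  ultimately have "tight V (cross_edges (C \<union> D) A) (0 + 0)"
    using Suc.prems(4) CD(1,2) by (intro tight_cross_Un) auto
  then show ?case by (simp add: CD(1))
qed

text \<open>\<open>A\<close> is cut into \<open>a\<close> sets of six vertices, each joined to
  \<open>B\<close> by \<open>tight_cross_six\<close>.\<close>

lemma tight_cross:
  assumes A: "finite A" "card (A \<inter> V) = 4 * a" "card (A - V) = 2 * a"
    and B: "finite B" "card (B \<inter> V) = 4 * c + d" "card (B - V) = 2 * c + d" "A \<inter> B = {}"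
  shows "tight V (cross_edges A B) 0"
  using A B(4)
proof (induction a arbitrary: A)
  case 0
  then have "A = {}" using empty_if_card_parts[of A V] by simp
  then show ?case by (simp add: tight_empty)
next
  case (Suc a)
  have "card (A \<inter> V) = 4 + 4 * a" "card (A - V) = 2 + 2 * a"
    using Suc.prems(2,3) by simp_all
  with Suc.prems(1) obtain C D where CD: "A = C \<union> D" "C \<inter> D = {}"
    "card (C \<inter> V) = 4" "card (C - V) = 2" "card (D \<inter> V) = 4 * a" "card (D - V) = 2 * a"
    by (rule split_set)
  have "tight V (cross_edges B C) 0"
    using B(1-3) CD Suc.prems(1,4) by (intro tight_cross_six) auto
  then have "tight V (cross_edges C B) 0" by (subst cross_edges_commute)
  moreover have "tight V (cross_edges D B) 0"
    using Suc.prems(1,4) CD by (intro Suc.IH) auto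
  ultimately have "tight V (cross_edges (C \<union> D) B) (0 + 0)"
    using Suc.prems(4) CD(1,2) by (intro tight_cross_Un) auto
  then show ?case by (simp add: CD(1))
qed

subsection \<open>Complete graphs with a hole\<close>

text \<open>The parameters \<open>h\<close> and \<open>k\<close> count the vertices of the hole \<open>H\<close> inside and outside \<open>V\<close>, and \<open>a\<close> and
  \<open>b\<close> those of the remaining set \<open>A\<close>.\<close>

definition hole_design :: "nat \<Rightarrow> nat \<Rightarrow> nat \<Rightarrow> nat \<Rightarrow> nat \<Rightarrow> bool" where
  "hole_design h k a b t \<longleftrightarrow> (\<forall>V H A :: nat set. finite H \<and> finite A \<and> H \<inter> A = {} \<and>
     card (H \<inter> V) = h \<and> card (H - V) = k \<and> card (A \<inter> V) = a \<and> card (A - V) = b \<longrightarrow>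
     tight V (complete_edges (H \<union> A) - complete_edges H) t)"

lemma complete_edges_empty [simp]: "complete_edges {} = {}"
  by (auto simp: complete_edges_def)

lemma complete_design_iff:
  "hole_design 0 0 v w t \<longleftrightarrow> (\<forall>V X :: nat set. finite X \<and> card (X \<inter> V) = v \<and> card (X - V) = w
    \<longrightarrow> tight V (complete_edges X) t)"
proof -
  have "(finite H \<and> finite A \<and> H \<inter> A = {} \<and> card (H \<inter> V) = 0 \<and> card (H - V) = 0 \<and> Q) \<longleftrightarrow>
     H = {} \<and> finite A \<and> Q" for H A V :: "nat set" and Q
    using empty_if_card_parts[of H V] by auto
  then show ?thesis by (simp add: hole_design_def)
qed

text \<open>The vertices below \<open>v\<close> play the role of \<open>V\<close>; those of the hole
  are listed in \<open>hs\<close>, which may lie anywhere below \<open>n\<close>.\<close>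

lemma hole_design_certificate:
  assumes "certificate n v (\<lambda>i j. \<not> (i \<in> set hs \<and> j \<in> set hs)) bs t"
    and "distinct hs" "\<forall>i\<in>set hs. i < n"
    and "h = length (filter (\<lambda>i. i < v) hs)" "k = length (filter (\<lambda>i. \<not> i < v) hs)"
    and "v = h + a" "n = v + k + b"
  shows "hole_design h k a b t"
  unfolding hole_design_def
proof (intro allI impI, elim conjE)
  fix V H A :: "nat set"
  assume HA: "finite H" "finite A" "H \<inter> A = {}" "card (H \<inter> V) = h" "card (H - V) = k"
    "card (A \<inter> V) = a" "card (A - V) = b"
  let ?H = "set hs" and ?A = "{..<n} - set hs"
  have H: "?H \<subseteq> {..<n}" using assms(3) by auto
  have "?H \<inter> {..<v} = set (filter (\<lambda>i. i < v) hs)" "?H - {..<v} = set (filter (\<lambda>i. \<not> i < v) hs)"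
    by auto
  then have c: "card (?H \<inter> {..<v}) = h" "card (?H - {..<v}) = k"
    using assms(2,4,5) by (simp_all only: distinct_card distinct_filter)
  have "?A \<inter> {..<v} = {..<v} - ?H \<inter> {..<v}" "?A - {..<v} = {v..<n} - (?H - {..<v})"
    using assms(7) by auto
  moreover have "card ({..<v} - ?H \<inter> {..<v}) = v - h"
    using c(1) by (subst card_Diff_subset) auto
  moreover have "card ({v..<n} - (?H - {..<v})) = n - v - k"
    using c(2) H by (subst card_Diff_subset) (auto simp: subset_iff)
  ultimately have "card (?A \<inter> {..<v}) = a" "card (?A - {..<v}) = b"
    using assms(6,7) by simp_all
  note cards = c this
  have "?H \<union> ?A = {..<n}" using H by blast
  then have "tight {..<v} (complete_edges (?H \<union> ?A) - complete_edges ?H) t"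
    using tight_certificate_hole[OF assms(1)] by simp
  then show "tight V (complete_edges (H \<union> A) - complete_edges H) t"
    by (rule tight_hole_transfer) (simp_all add: HA cards)
qed

text \<open>With \<open>X\<close> split into \<open>H\<close>, \<open>A\<close> and
  \<open>B\<close>, the complete graph on \<open>X\<close> consists of the one on
  \<open>H \<union> A\<close> without the hole \<open>H\<close>, the one on
  \<open>H \<union> B\<close>, and all edges between \<open>A\<close> and \<open>B\<close>. The last
  part consists of 4-cycles, so only \<open>s\<close> and \<open>t\<close> contribute missing
  edges.\<close>

lemma hole_design_fill:
  assumes hole: "hole_design h k p q s" and complete: "hole_design 0 0 v w t"
    and pq: "p = 4 * a" "q = 2 * a" and vw: "v = h + (4 * c + d)" "w = k + (2 * c + d)"
    and sums: "v' = v + p" "w' = w + q" "t' = s + t"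
  shows "hole_design 0 0 v' w' t'"
  unfolding complete_design_iff
proof (intro allI impI, elim conjE)
  fix V X :: "nat set"
  assume "finite X" "card (X \<inter> V) = v'" "card (X - V) = w'"
  then have X: "finite X" "card (X \<inter> V) = h + (4 * (a + c) + d)"
    "card (X - V) = k + (2 * (a + c) + d)"
    using pq vw sums by simp_all
  obtain H Y where HY: "X = H \<union> Y" "H \<inter> Y = {}" "card (H \<inter> V) = h" "card (H - V) = k"
    "card (Y \<inter> V) = 4 * (a + c) + d" "card (Y - V) = 2 * (a + c) + d"
    by (rule split_set[OF X])
  have "finite Y" "card (Y \<inter> V) = 4 * a + (4 * c + d)" "card (Y - V) = 2 * a + (2 * c + d)"
    using X(1) HY by simp_all
  then obtain A B where AB: "Y = A \<union> B" "A \<inter> B = {}" "card (A \<inter> V) = 4 * a" "card (A - V) = 2 * a"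
    "card (B \<inter> V) = 4 * c + d" "card (B - V) = 2 * c + d"
    by (rule split_set)
  have fin: "finite H" "finite A" "finite B" using X(1) HY(1) AB(1) by auto
  have disj: "H \<inter> A = {}" "H \<inter> B = {}" using HY(2) AB(1) by auto
  have A: "tight V (complete_edges (H \<union> A) - complete_edges H) s"
    using hole fin disj HY AB unfolding hole_design_def pq by blast
  have "card ((H \<union> B) \<inter> V) = h + (4 * c + d)" "card (H \<union> B - V) = k + (2 * c + d)"
    unfolding Int_Un_distrib2 Un_Diff using fin disj HY(3,4) AB(5,6)
    by (subst card_Un_disjoint; auto)+
  then have B: "tight V (complete_edges (H \<union> B)) t"
    using complete fin unfolding complete_design_iff vw by blast
  have C: "tight V (cross_edges A B) 0"
    using tight_cross fin AB by blast
  \<comment> \<open>Since \<open>A\<close> and \<open>B\<close> are disjoint, an edge in both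
    complete graphs lies inside \<open>H\<close>.\<close>
  have "(complete_edges (H \<union> A) - complete_edges H) \<inter> complete_edges (H \<union> B) = {}"
    using AB(2) unfolding complete_edges_def by blast
  from tight_Un[OF A B this]
  have AB': "tight V ((complete_edges (H \<union> A) - complete_edges H) \<union> complete_edges (H \<union> B)) (s + t)" .
  have "((complete_edges (H \<union> A) - complete_edges H) \<union> complete_edges (H \<union> B)) \<inter> cross_edges A B = {}"
    using disj AB(2) by (auto elim!: cross_edgesE)
  from tight_Un[OF AB' C this]
  have "tight V ((complete_edges (H \<union> A) - complete_edges H) \<union> complete_edges (H \<union> B) \<union> cross_edges A B) (s + t)"
    by simp
  moreover have "(complete_edges (H \<union> A) - complete_edges H) \<union> complete_edges (H \<union> B) \<union> cross_edges A B
    = complete_edges X" (is "?L = ?R")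
  proof
    have "complete_edges (H \<union> A) \<subseteq> complete_edges X" "complete_edges (H \<union> B) \<subseteq> complete_edges X"
      unfolding HY(1) AB(1) by (auto intro!: complete_edges_mono)
    moreover have "cross_edges A B \<subseteq> complete_edges X"
      using AB(1,2) HY(1) by (auto elim!: cross_edgesE)
    ultimately show "?L \<subseteq> ?R" by blast
    show "?R \<subseteq> ?L"
    proof
      fix e assume "e \<in> ?R"
      then obtain i j where "i \<in> X" "j \<in> X" "i \<noteq> j" "e = {i, j}" by (auto simp: mem_complete_edges)
      then show "e \<in> ?L" unfolding HY(1) AB(1) by (auto simp: mem_cross_edges)
    qed
  qed
  ultimately show "tight V (complete_edges X) t'" using sums by simp
qed

lemma hole_design_fill_iterate:
  assumes "hole_design h k 16 8 0" "hole_design 0 0 v w t" "v = h + (4 * c + d)" "w = k + (2 * c + d)"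
  shows "hole_design 0 0 (v + 16 * m) (w + 8 * m) t"
proof (induction m)
  case (Suc m)
  show ?case
    \<comment> \<open>The new \<open>A\<close> consists of four six-sets. The 24 vertices of each
      earlier round have joined \<open>B\<close>, raising \<open>c\<close> by four per round and
      keeping \<open>d\<close>.\<close>
    by (rule hole_design_fill[OF assms(1) Suc, of 4 "4 * m + c" d]) (simp_all add: assms(3,4))
qed (use assms(2) in simp)

text \<open>Designs speak about sets of natural numbers; a transfer with empty hole brings them to
  any type.\<close>

lemma tight_complete_design:
  fixes X :: "'a set"
  assumes "hole_design 0 0 v w t" "finite X" "card (X \<inter> V) = v" "card (X - V) = w"
  shows "tight V (complete_edges X) t"
proof -
  have "{..<v + w} \<inter> {..<v} = {..<v}" "{..<v + w} - {..<v} = {v..<v + w}" by auto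
  then have c: "card ({..<v + w} \<inter> {..<v}) = v" "card ({..<v + w} - {..<v}) = w" by auto
  then have "tight {..<v} (complete_edges {..<v + w}) t"
    using assms(1) unfolding complete_design_iff by blast
  then show ?thesis
    using tight_hole_transfer[of "{..<v}" "{}" "{..<v + w}" t "{}" X V] assms c by simp
qed

subsection \<open>Existence for all orders\<close>

text \<open>The block lists come from a randomised local search.\<close>

lemma design_0_0: "hole_design 0 0 0 0 0"
  by (rule hole_design_certificate[where n = 0 and v = 0 and hs = "[]" and bs =
    "[]"])
    (code_simp, simp_all)

lemma design_0_1: "hole_design 0 0 0 1 0"
  by (rule hole_design_certificate[where n = 1 and v = 0 and hs = "[]" and bs =
    "[]"])
    (code_simp, simp_all)

lemma design_2_1: "hole_design 0 0 2 1 1"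
  by (rule hole_design_certificate[where n = 3 and v = 2 and hs = "[]" and bs =
    "[Tri 0 1 2]"])
    (code_simp, simp_all)

lemma design_3_2: "hole_design 0 0 3 2 2"
  by (rule hole_design_certificate[where n = 5 and v = 3 and hs = "[]" and bs =
    "[Tri 2 4 0, Cyc 3 4 1 2, Tri 0 1 3]"])
    (code_simp, simp_all)

lemma design_4_2: "hole_design 0 0 4 2 1"
  by (rule hole_design_certificate[where n = 6 and v = 4 and hs = "[]" and bs =
    "[Paw 5 3 2 4, Paw 0 3 4 2, Tri 4 2 1, Paw 1 0 5 3]"])
    (code_simp, simp_all)

lemma design_4_3: "hole_design 0 0 4 3 3"
  by (rule hole_design_certificate[where n = 7 and v = 4 and hs = "[]" and bs =
    "[Tri 6 3 0, Tri 0 5 2, Cyc 5 3 4 6, Tri 4 0 1, Cyc 2 1 5 4, Cyc 6 1 3 2]"])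
    (code_simp, simp_all)

lemma design_5_3: "hole_design 0 0 5 3 0"
  by (rule hole_design_certificate[where n = 8 and v = 5 and hs = "[]" and bs =
    "[Paw 1 5 2 6, Cyc 0 3 5 4, Cyc 4 1 3 7, Paw 4 3 6 2, Paw 2 6 0 3, Paw 7 0 1 2, Paw 5 7 6 0]"])
    (code_simp, simp_all)

lemma design_6_3: "hole_design 0 0 6 3 0"
  by (rule hole_design_certificate[where n = 9 and v = 6 and hs = "[]" and bs =
    "[Paw 4 0 7 3, Cyc 6 5 3 7, Cyc 5 0 6 4, Cyc 7 8 1 5, Paw 2 5 8 3, Cyc 6 1 0 3, Paw 2 7 1 4,
      Cyc 4 8 3 1, Cyc 6 2 0 8]"])
    (code_simp, simp_all)

lemma design_6_4: "hole_design 0 0 6 4 3"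
  by (rule hole_design_certificate[where n = 10 and v = 6 and hs = "[]" and bs =
    "[Paw 4 6 0 5, Cyc 7 8 4 3, Cyc 0 2 5 7, Paw 3 1 6 2, Paw 6 2 8 5, Tri 1 0 8, Paw 0 9 3 5,
      Tri 9 7 6, Tri 1 2 7, Paw 8 3 5 9, Paw 4 9 2 7, Paw 1 5 9 4]"])
    (code_simp, simp_all)

lemma design_7_4: "hole_design 0 0 7 4 1"
  by (rule hole_design_certificate[where n = 11 and v = 7 and hs = "[]" and bs =
    "[Cyc 2 6 10 1, Paw 2 0 8 5, Cyc 3 2 7 4, Paw 2 10 9 4, Paw 0 5 9 6, Paw 8 9 7 3, Paw 6 9 4
      1, Paw 0 3 10 4, Paw 8 6 5 10, Cyc 3 6 7 5, Paw 7 1 0 3, Tri 4 1 8, Paw 1 9 3 5, Paw 10 5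
      4 7]"])
    (code_simp, simp_all)

lemma design_8_5: "hole_design 0 0 8 5 2"
  by (rule hole_design_certificate[where n = 13 and v = 8 and hs = "[]" and bs =
    "[Paw 4 7 8 1, Paw 9 1 2 12, Cyc 7 2 6 11, Cyc 0 5 10 2, Cyc 5 3 2 12, Cyc 9 4 0 10, Cyc 11
      5 6 0, Paw 7 6 10 5, Cyc 1 10 12 7, Paw 12 0 3 4, Paw 1 3 11 5, Tri 12 11 8, Cyc 4 5 8 2,
      Paw 4 10 11 3, Paw 9 8 6 3, Paw 7 9 0 3, Cyc 9 5 2 11, Paw 6 12 1 4, Tri 8 0 1, Paw 3 10 8
      6]"])
    (code_simp, simp_all)

lemma design_10_6: "hole_design 0 0 10 6 0"
  by (rule hole_design_certificate[where n = 16 and v = 10 and hs = "[]" and bs =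
    "[Cyc 10 15 11 1, Paw 5 15 7 8, Paw 1 15 4 5, Paw 6 2 10 9, Cyc 3 6 0 14, Paw 11 6 4 13, Paw
      1 14 2 8, Cyc 9 7 11 12, Paw 8 12 0 9, Paw 4 10 3 2, Paw 3 2 12 5, Paw 6 15 14 1, Cyc 9 0
      10 5, Cyc 0 2 13 5, Cyc 6 5 4 12, Cyc 11 5 12 10, Paw 8 15 2 14, Paw 7 13 3 6, Cyc 15 13 1
      9, Cyc 4 9 10 7, Cyc 1 3 15 0, Cyc 4 8 10 14, Cyc 14 5 2 11, Cyc 0 7 8 11, Paw 9 3 11 13,
      Paw 8 6 13 3, Paw 12 7 1 15, Paw 0 13 4 3, Cyc 7 2 9 14, Paw 13 12 14 10]"])
    (code_simp, simp_all)

lemma design_11_6: "hole_design 0 0 11 6 0"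
  by (rule hole_design_certificate[where n = 17 and v = 11 and hs = "[]" and bs =
    "[Paw 8 16 12 7, Cyc 3 5 2 14, Cyc 5 1 12 10, Cyc 6 9 15 12, Paw 6 14 16 1, Paw 8 13 2 3,
      Paw 0 16 2 6, Cyc 7 9 0 14, Paw 2 11 3 1, Cyc 7 13 16 3, Cyc 6 10 0 15, Paw 12 14 13 11,
      Cyc 9 8 4 16, Paw 7 16 5 1, Paw 9 1 13 5, Cyc 8 0 1 14, Paw 6 13 4 2, Cyc 10 1 8 15, Paw
      10 4 14 7, Cyc 10 8 5 13, Paw 3 13 0 6, Paw 12 0 5 4, Paw 6 8 11 5, Paw 10 9 11 2, Paw 1
      15 11 4, Cyc 11 16 15 13, Paw 11 5 14 0, Paw 7 12 2 6, Cyc 4 3 15 2, Cyc 11 7 0 4, Cyc 10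
      16 1 3, Cyc 5 4 7 15, Cyc 15 14 9 4, Paw 9 3 12 2]"])
    (code_simp, simp_all)

lemma design_12_7: "hole_design 0 0 12 7 1"
  by (rule hole_design_certificate[where n = 19 and v = 12 and hs = "[]" and bs =
    "[Paw 13 2 10 11, Paw 2 16 1 5, Cyc 10 3 4 12, Paw 18 8 4 13, Cyc 1 6 7 15, Paw 7 0 16 10,
      Cyc 17 1 10 4, Tri 0 12 6, Paw 11 15 4 16, Paw 5 3 12 10, Cyc 8 10 16 6, Paw 11 18 10 7,
      Paw 7 8 13 1, Cyc 5 16 3 7, Paw 18 3 0 16, Cyc 5 0 14 4, Cyc 9 11 1 18, Cyc 17 18 6 11,
      Cyc 15 17 5 18, Cyc 18 14 16 12, Paw 3 14 1 15, Paw 7 12 14 9, Cyc 5 1 0 15, Paw 15 13 14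
      12, Cyc 0 2 14 9, Paw 2 17 7 3, Cyc 8 2 6 17, Cyc 5 6 15 8, Paw 4 16 13 1, Cyc 0 10 14 8,
      Cyc 4 7 18 2, Paw 12 17 13 11, Cyc 5 9 6 14, Cyc 8 16 9 3, Cyc 9 12 1 8, Cyc 11 5 13 3,
      Cyc 6 4 0 13, Cyc 17 16 15 9, Paw 9 13 1 4, Cyc 17 14 11 0, Cyc 3 6 10 17, Cyc 11 2 12 8,
      Cyc 15 10 9 2]"])
    (code_simp, simp_all)

text \<open>Besides being a base case of its own size, this is the increment by 24 vertices for the
  empty hole. No edge is missing, so it can be repeated without changing \<open>t\<close>.\<close>

lemma design_16_8: "hole_design 0 0 16 8 0"
  by (rule hole_design_certificate[where n = 24 and v = 16 and hs = "[]" and bs =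
    "[Paw 3 9 23 1, Cyc 10 4 15 16, Cyc 11 9 20 12, Paw 8 14 18 9, Cyc 7 12 14 23, Cyc 10 14 2
      17, Cyc 17 19 18 16, Cyc 10 0 21 1, Cyc 7 5 18 2, Cyc 6 3 7 16, Paw 0 7 20 5, Paw 8 19 7
      6, Cyc 13 15 11 17, Cyc 18 0 4 13, Cyc 11 8 4 18, Cyc 4 2 9 21, Cyc 16 20 18 23, Paw 12 21
      17 4, Cyc 15 5 19 10, Cyc 5 3 4 17, Paw 7 22 13 10, Cyc 7 4 19 9, Cyc 1 8 16 0, Paw 22 21
      18 20, Paw 9 16 5 10, Paw 5 8 22 6, Cyc 20 21 6 2, Paw 11 16 3 13, Paw 23 12 8 21, Paw 0 6
      23 15, Cyc 0 13 8 17, Paw 15 17 14 8, Cyc 9 4 16 14, Cyc 13 1 15 21, Cyc 4 6 1 20, Cyc 10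
      8 3 18, Cyc 7 14 6 17, Paw 2 11 19 12, Cyc 5 2 23 10, Paw 3 10 22 12, Cyc 11 6 20 5, Paw
      13 23 5 6, Paw 4 23 1 11, Cyc 6 12 13 19, Cyc 1 7 18 17, Paw 2 13 16 0, Cyc 12 10 11 22,
      Paw 20 13 10 3, Cyc 9 13 3 17, Cyc 0 8 21 11, Paw 2 3 21 10, Paw 5 21 14 4, Cyc 9 15 22 6,
      Paw 18 12 9 1, Paw 15 6 18 12, Cyc 3 15 19 14, Paw 19 23 20 21, Paw 14 11 20 13, Cyc 15 7
      11 23, Paw 0 3 19 12, Cyc 6 10 21 7, Paw 9 22 1 0, Paw 1 12 19 11, Cyc 1 5 12 16, Cyc 2 15
      20 8, Paw 16 22 19 21, Cyc 0 14 4 22, Cyc 2 1 14 22, Paw 17 23 22 20]"])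
    (code_simp, simp_all)

lemma hole_design_16_8_hole_0_1: "hole_design 0 1 16 8 0"
  by (rule hole_design_certificate[where n = 25 and v = 16 and hs = "[24]" and bs =
    "[Paw 4 3 18 23, Paw 5 12 20 7, Cyc 9 4 19 11, Paw 12 2 23 0, Paw 14 23 3 4, Paw 10 22 2 7,
      Paw 1 14 24 15, Cyc 22 16 6 15, Paw 20 21 16 1, Paw 17 6 23 16, Cyc 9 18 2 13, Paw 11 4 20
      3, Cyc 8 12 1 23, Paw 3 16 8 1, Cyc 6 10 1 18, Cyc 17 24 9 1, Cyc 11 8 18 5, Paw 14 11 18
      5, Cyc 4 12 11 16, Paw 6 13 20 1, Cyc 7 12 16 15, Paw 6 9 21 5, Paw 5 16 1 23, Paw 16 2 0
      18, Paw 10 15 18 9, Paw 3 22 21 0, Cyc 1 7 23 13, Cyc 7 11 10 17, Paw 0 18 13 14, Cyc 7 2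
      20 18, Paw 20 8 15 7, Cyc 15 2 3 19, Cyc 2 24 15 5, Cyc 6 0 20 3, Paw 7 22 6 13, Paw 14 12
      19 10, Cyc 2 11 22 14, Paw 13 21 15 11, Cyc 16 23 20 19, Paw 17 20 22 2, Cyc 2 8 22 9, Cyc
      17 5 0 19, Paw 15 17 12 4, Paw 3 13 24 5, Cyc 18 21 23 22, Paw 7 8 24 9, Paw 11 17 21 6,
      Paw 7 0 21 3, Cyc 14 6 12 21, Paw 4 5 22 2, Cyc 5 13 22 19, Paw 19 24 21 1, Paw 0 4 17 15,
      Cyc 0 10 24 11, Cyc 4 7 16 13, Cyc 24 4 1 0, Cyc 15 14 16 9, Paw 9 20 14 8, Cyc 10 4 21 8,
      Paw 6 19 2 4, Cyc 9 0 23 19, Paw 15 23 11 3, Cyc 7 14 13 19, Cyc 3 9 23 10, Paw 8 14 17 4,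
      Paw 18 24 23 19, Cyc 8 0 22 1, Cyc 5 8 6 24, Cyc 3 12 9 17, Paw 12 24 22 10, Paw 5 10 21
      9, Cyc 19 8 13 10, Cyc 13 12 18 17, Cyc 20 24 16 10, Paw 1 2 21 11]"])
    (code_simp, simp_all)

text \<open>There are 66 edges among the twelve new vertices and 36 to the hole, so two missing
  edges are the least possible.\<close>

lemma hole_design_8_4_hole_2_1: "hole_design 2 1 8 4 2"
  by (rule hole_design_certificate[where n = 15 and v = 10 and hs = "[0, 1, 14]" and bs =
    "[Paw 12 14 11 2, Tri 13 2 4, Cyc 9 0 13 5, Cyc 1 3 12 8, Paw 9 4 11 6, Tri 2 0 11, Cyc 13
      11 10 14, Paw 3 9 14 8, Cyc 8 4 6 14, Paw 7 1 13 4, Paw 6 1 12 8, Paw 6 3 11 2, Paw 6 5 10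
      0, Cyc 5 1 11 7, Paw 0 8 10 5, Cyc 2 3 13 9, Paw 2 10 1 7, Cyc 7 14 4 0, Paw 2 14 5 8, Cyc
      7 6 13 8, Cyc 5 3 0 12, Paw 5 11 8 4, Cyc 1 4 10 9, Paw 3 7 10 4, Paw 9 12 7 8, Paw 12 10
      13 4]"])
    (code_simp, simp_all)

lemma hole_design_16_8_hole_2_1: "hole_design 2 1 16 8 0"
  by (rule hole_design_certificate[where n = 27 and v = 18 and hs = "[0, 1, 26]" and bs =
    "[Paw 6 23 3 8, Paw 13 26 11 15, Cyc 12 7 19 0, Cyc 10 15 8 22, Cyc 14 2 22 26, Cyc 5 12 4
      21, Cyc 21 10 9 1, Paw 8 10 23 13, Cyc 16 6 19 11, Paw 4 24 15 5, Paw 9 6 21 16, Cyc 11 6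
      15 22, Paw 13 6 22 14, Paw 25 12 6 2, Cyc 20 22 23 25, Paw 14 24 8 10, Paw 2 24 5 0, Cyc 1
      25 5 8, Cyc 4 0 25 11, Cyc 26 20 24 25, Cyc 5 17 12 19, Paw 0 16 22 10, Paw 9 22 25 2, Paw
      25 18 21 19, Cyc 2 10 26 16, Cyc 11 2 19 8, Cyc 4 14 5 20, Paw 7 4 22 6, Cyc 0 3 8 21, Paw
      0 7 18 14, Cyc 12 2 15 20, Cyc 24 22 19 26, Paw 4 16 25 10, Paw 10 20 1 17, Paw 11 3 20
      17, Cyc 18 23 21 22, Cyc 2 6 4 26, Paw 1 4 18 11, Cyc 17 1 15 18, Paw 12 26 8 10, Cyc 0 6
      24 17, Cyc 14 12 23 7, Paw 11 21 14 10, Cyc 11 7 21 12, Paw 15 14 23 0, Cyc 8 4 9 20, Cyc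
      15 25 14 9, Cyc 0 8 2 23, Cyc 1 13 21 2, Paw 5 18 11 15, Paw 17 8 25 16, Paw 19 18 20 24,
      Paw 16 1 24 18, Cyc 19 23 20 21, Paw 6 18 14 17, Paw 16 21 3 5, Paw 17 23 4 7, Cyc 24 3 7
      9, Cyc 13 0 24 10, Paw 3 10 25 15, Paw 17 15 21 9, Paw 1 22 12 3, Cyc 5 7 25 13, Cyc 13 17
      26 9, Paw 16 20 14 8, Cyc 16 15 19 10, Paw 1 19 14 6, Paw 9 19 3 8, Cyc 11 0 9 23, Cyc 23
      24 21 26, Cyc 4 3 17 19, Paw 7 13 24 1, Cyc 15 11 24 12, Cyc 4 13 18 2, Paw 14 22 17 3,
      Cyc 5 10 6 26, Paw 13 19 16 2, Cyc 16 12 13 23, Cyc 20 17 2 7, Paw 7 15 26 16, Paw 9 18 12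
      11, Cyc 5 6 20 0, Cyc 3 13 20 2, Paw 3 22 5 12, Paw 5 23 1 9, Cyc 7 8 18 10, Paw 18 26 3
      24]"])
    (code_simp, simp_all)

section \<open>Medium orders assembled from smaller designs\<close>

text \<open>Six vertices are added by means of \<open>design_4_2\<close>. Every such extension costs
  one missing edge, so it can be repeated only while the total stays below four.\<close>

lemma design_8_4: "hole_design 0 0 8 4 2"
  by (rule hole_design_fill[OF design_4_2 design_4_2, of 1 1 0]) simp_all

lemma design_12_6: "hole_design 0 0 12 6 3"
  by (rule hole_design_fill[OF design_4_2 design_8_4, of 1 2 0]) simp_all

lemma design_9_5: "hole_design 0 0 9 5 1"
  by (rule hole_design_fill[OF design_4_2 design_5_3, of 1 1 1]) simp_all

lemma design_13_7: "hole_design 0 0 13 7 2"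
  by (rule hole_design_fill[OF design_4_2 design_9_5, of 1 2 1]) simp_all

lemma design_17_9: "hole_design 0 0 17 9 3"
  by (rule hole_design_fill[OF design_4_2 design_13_7, of 1 3 1]) simp_all

lemma design_14_8: "hole_design 0 0 14 8 1"
  by (rule hole_design_fill[OF design_4_2 design_10_6, of 1 2 2]) simp_all

lemma design_18_10: "hole_design 0 0 18 10 2"
  by (rule hole_design_fill[OF design_4_2 design_14_8, of 1 3 2]) simp_all

lemma design_10_5: "hole_design 0 0 10 5 3"
  by (rule hole_design_fill[OF hole_design_8_4_hole_2_1 design_2_1, of 2 0 0]) simp_all

lemma design_14_7: "hole_design 0 0 14 7 2"
  by (rule hole_design_fill[OF hole_design_8_4_hole_2_1 design_6_3, of 2 1 0]) simp_all

lemma design_15_8: "hole_design 0 0 15 8 3"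
  by (rule hole_design_fill[OF hole_design_8_4_hole_2_1 design_7_4, of 2 1 1]) simp_all

section \<open>All residues modulo 24\<close>

text \<open>Adding 16 vertices inside and 8 outside \<open>V\<close> raises both sides of
  \<open>2 * w \<le> v + 2\<close> by 16, so the inequality persists.\<close>

lemma large_complete_design_shift:
  assumes "hole_design h k 16 8 0" "hole_design 0 0 v w t"
    and "v = h + (4 * c + d)" "w = k + (2 * c + d)" "2 * w \<le> v + 2" "t < 4"
    and "n = 24 * m + (v + w)"
  shows "\<exists>v' w' t. v' + w' = n \<and> 2 * w' \<le> v' + 2 \<and> t < 4 \<and> hole_design 0 0 v' w' t"
  using hole_design_fill_iterate[OF assms(1-4), of m] assms(5-7)
  by (intro exI[of _ "v + 16 * m"] exI[of _ "w + 8 * m"] exI[of _ t]) simp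

text \<open>The vertices outside the hole number \<open>6 * c + 2 * d\<close>, so the parity of
  \<open>n\<close> dictates that of the hole. Even \<open>n\<close> use the empty hole. Among odd
  \<open>n\<close>, residue 1 modulo 6 uses one vertex outside \<open>V\<close>, and residues 3 and
  5 use three vertices, two of them in \<open>V\<close>.\<close>

lemma large_complete_design:
  fixes n :: nat
  assumes "5 \<le> n"
  shows "\<exists>v w t. v + w = n \<and> 2 * w \<le> v + 2 \<and> t < 4 \<and> hole_design 0 0 v w t"
    (is "?good n")
proof -
  have r0: "?good (24 * m + 0)" for m
    by (rule large_complete_design_shift[OF design_16_8 design_0_0, of 0 0 _ m]) simp_all
  have r1: "?good (24 * m + 1)" for m
    by (rule large_complete_design_shift[OF hole_design_16_8_hole_0_1 design_0_1, of 0 0 _ m]) simp_all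
  have r3: "?good (24 * m + 3)" for m
    by (rule large_complete_design_shift[OF hole_design_16_8_hole_2_1 design_2_1, of 0 0 _ m]) simp_all
  have r5: "?good (24 * m + 5)" for m
    by (rule large_complete_design_shift[OF hole_design_16_8_hole_2_1 design_3_2, of 0 1 _ m]) simp_all
  have r6: "?good (24 * m + 6)" for m
    by (rule large_complete_design_shift[OF design_16_8 design_4_2, of 1 0 _ m]) simp_all
  have r7: "?good (24 * m + 7)" for m
    by (rule large_complete_design_shift[OF hole_design_16_8_hole_0_1 design_4_3, of 1 0 _ m]) simp_all
  have r8: "?good (24 * m + 8)" for m
    by (rule large_complete_design_shift[OF design_16_8 design_5_3, of 1 1 _ m]) simp_all
  have r9: "?good (24 * m + 9)" for m
    by (rule large_complete_design_shift[OF hole_design_16_8_hole_2_1 design_6_3, of 1 0 _ m]) simp_all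
  have r10: "?good (24 * m + 10)" for m
    by (rule large_complete_design_shift[OF design_16_8 design_6_4, of 1 2 _ m]) simp_all
  have r11: "?good (24 * m + 11)" for m
    by (rule large_complete_design_shift[OF hole_design_16_8_hole_2_1 design_7_4, of 1 1 _ m]) simp_all
  have r12: "?good (24 * m + 12)" for m
    by (rule large_complete_design_shift[OF design_16_8 design_8_4, of 2 0 _ m]) simp_all
  have r13: "?good (24 * m + 13)" for m
    by (rule large_complete_design_shift[OF hole_design_16_8_hole_0_1 design_8_5, of 2 0 _ m]) simp_all
  have r14: "?good (24 * m + 14)" for m
    by (rule large_complete_design_shift[OF design_16_8 design_9_5, of 2 1 _ m]) simp_all
  have r15: "?good (24 * m + 15)" for m
    by (rule large_complete_design_shift[OF hole_design_16_8_hole_2_1 design_10_5, of 2 0 _ m]) simp_all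
  have r16: "?good (24 * m + 16)" for m
    by (rule large_complete_design_shift[OF design_16_8 design_10_6, of 2 2 _ m]) simp_all
  have r17: "?good (24 * m + 17)" for m
    by (rule large_complete_design_shift[OF hole_design_16_8_hole_2_1 design_11_6, of 2 1 _ m]) simp_all
  have r18: "?good (24 * m + 18)" for m
    by (rule large_complete_design_shift[OF design_16_8 design_12_6, of 3 0 _ m]) simp_all
  have r19: "?good (24 * m + 19)" for m
    by (rule large_complete_design_shift[OF hole_design_16_8_hole_0_1 design_12_7, of 3 0 _ m]) simp_all
  have r20: "?good (24 * m + 20)" for m
    by (rule large_complete_design_shift[OF design_16_8 design_13_7, of 3 1 _ m]) simp_all
  have r21: "?good (24 * m + 21)" for m
    by (rule large_complete_design_shift[OF hole_design_16_8_hole_2_1 design_14_7, of 3 0 _ m]) simp_all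
  have r22: "?good (24 * m + 22)" for m
    by (rule large_complete_design_shift[OF design_16_8 design_14_8, of 3 2 _ m]) simp_all
  have r23: "?good (24 * m + 23)" for m
    by (rule large_complete_design_shift[OF hole_design_16_8_hole_2_1 design_15_8, of 3 1 _ m]) simp_all
  \<comment> \<open>Complete graphs on two or four vertices have no tight partition: blocks with one
    or two edges are not tight, and any two triangles on four vertices share an edge. Residues 2 and
    4 therefore start at 26 and 28.\<close>
  have r26: "?good (24 * m + 26)" for m
    by (rule large_complete_design_shift[OF design_16_8 design_17_9, of 4 1 _ m]) simp_all
  have r28: "?good (24 * m + 28)" for m
    by (rule large_complete_design_shift[OF design_16_8 design_18_10, of 4 2 _ m]) simp_all
  define m r where "m = n div 24" and "r = n mod 24"
  then have n: "n = 24 * m + r" by simp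
  have "[0..<24] =
      [0, 1, 2, 3, 4, 5, 6, 7, 8, 9, 10, 11, 12, 13, 14, 15, 16, 17, 18, 19, 20, 21, 22, 23]" by code_simp
  moreover have "r \<in> set [0..<24]" by (simp add: r_def)
  ultimately have r: "r \<in> set
      [0, 1, 2, 3, 4, 5, 6, 7, 8, 9, 10, 11, 12, 13, 14, 15, 16, 17, 18, 19, 20, 21, 22, 23]" by (simp only:)
  have small: "?good n" if "r = 2 \<or> r = 4"
  proof -
    \<comment> \<open>Otherwise \<open>n\<close> would be 2 or 4, contrary to
      \<open>5 \<le> n\<close>.\<close>
    have "m \<noteq> 0" using that n assms by auto
    then obtain l where "m = Suc l" using not0_implies_Suc by blast
    then have "n = 24 * l + 26 \<or> n = 24 * l + 28" using that n by auto
    then show ?thesis using r26[of l] r28[of l] by (elim disjE) (simp_all only:)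
  qed
  show ?thesis
  proof (cases "r = 2 \<or> r = 4")
    case False
    with r show ?thesis
      unfolding n list.set insert_iff empty_iff
      using r0[of m] r1[of m] r3[of m] r5[of m] r6[of m] r7[of m] r8[of m] r9[of m] r10[of m] r11[of m] r12[of m] r13[of m] r14[of m] r15[of m] r16[of m] r17[of m] r18[of m] r19[of m] r20[of m] r21[of m] r22[of m] r23[of m]
      by (elim disjE) (simp_all only:, simp_all)
  qed (rule small)
qed

theorem theorem4p3:
  fixes v w :: nat and X V :: "'a set"
  assumes "finite X" and "card X = v + w"
    and "V \<subseteq> X" and "card V = v"
    and "v \<le> 2 * w"
  shows "wavecost_MON2 X V 4 2 = wavecost_MON X 4"
proof (cases "5 \<le> v + w")
  case True
  then obtain v' w' t where d: "v' + w' = v + w" "2 * w' \<le> v' + 2" "t < 4" "hole_design 0 0 v' w' t"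
    using large_complete_design by blast
  \<comment> \<open>If \<open>v > v'\<close>, then \<open>w \<le> w' - 1\<close>, so
    \<open>v \<le> 2 * w' - 2 \<le> v'\<close>, a contradiction. Hence \<open>V\<close> can be
    enlarged by a set \<open>T\<close> to size \<open>v'\<close>.\<close>
  have "v \<le> v'" using d(1,2) assms(5) by linarith
  have finV: "finite V" using assms(1,3) by (rule rev_finite_subset)
  have "v' - v \<le> card (X - V)"
    using finV assms(2-4) d(1) by (simp add: card_Diff_subset)
  then obtain T where T: "T \<subseteq> X - V" "card T = v' - v" "finite T"
    by (rule obtain_subset_with_card_n)
  have "V \<inter> T = {}" using T(1) by auto
  then have card: "card (V \<union> T) = v'"
    using finV T(2,3) assms(4) \<open>v \<le> v'\<close> by (simp add: card_Un_disjoint)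
  have sub: "V \<union> T \<subseteq> X" using assms(3) T(1) by auto
  then have "X \<inter> (V \<union> T) = V \<union> T" by auto
  moreover have "card (X - (V \<union> T)) = w'"
    using sub card finV T(3) assms(2) d(1) by (simp add: card_Diff_subset)
  ultimately have "tight (V \<union> T) (complete_edges X) t"
    using d(4) assms(1) card by (intro tight_complete_design) simp_all
  then have "tight V (complete_edges X) t" by (rule tight_mono) simp
  then show ?thesis using assms(1) d(3) by (intro wavecost_eq_if_tight)
next
  case False
  \<comment> \<open>From \<open>v \<le> 2 * w\<close> and \<open>v + w \<le> 4\<close> follows
    \<open>3 * v \<le> 8\<close>.\<close>
  then have "card V \<le> 2" using assms(4,5) by linarith
  then show ?thesis using finite_subset[OF assms(3,1)] by (intro wavecost_eq_if_card_le_2)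
qed

end
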